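(* Let $\varphi\colon\Gamma\to G$ be a group homomorphism with kernel $K=\ker\varphi$. Define $K_1=K$ and $K_{i+1}=[\Gamma,K_i]$ for $i\ge1$, and suppose that the descending series $K_1\ge K_2\ge\cdots$ terminates after a finite number of steps. Let $\mathcal{K}$ be its terminal member, and let $\rho\colon\Gamma/\mathcal{K}\to G$ be the map induced by $\varphi$. Then $\Gamma_{\infty,\varphi}\cong(\Gamma/\mathcal{K})_{\infty,\rho}$.
   Context: A series $\{H_i\}$ terminates if there is $t$ with $H_t=H_{t+1}=H_{t+2}=\cdots$; then $H_t$ is its terminal member. Composition is written right to left. A normal map (= crossed module) is a group homomorphism $n\colon M\to G$ together with a right action $m\mapsto m^g$ of $G$ on $M$ by automorphisms such that $n(m^g)=g^{-1}n(m)g$ and $m^{n(m')}=m'^{-1}mm'$ for all $m,m'\in M$, $g\in G$. Given normal maps $n\colon M\to G$ and $n'\colon M'\to G$, a normal morphism over $G$ is a homomorphism $\mu\colon M\to M'$ with $n'\circ\mu=n$ and $\mu(m^g)=\mu(m)^g$ for all $m\in M$, $g\in G$. The (free) normal closure of a homomorphism $\varphi\colon\Gamma\to G$ is the universal factorization $\Gamma\xrightarrow{c_\varphi}\Gamma^{\varphi}\xrightarrow{\overline{\varphi}}G$ of $\varphi$ with $\overline{\varphi}$ a normal map: for every factorization $\varphi=n\circ\psi$ with $\psi\colon\Gamma\to M$ a homomorphism and $n\colon M\to G$ a normal map there is a unique normal morphism $u\colon\Gamma^\varphi\to M$ over $G$ with $u\circ c_\varphi=\psi$. It exists and is unique up to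 unique isomorphism. The normal closures tower of $\varphi$ is defined by $\Gamma_1=\Gamma_{1,\varphi}=G$, $\varphi_1=\varphi$, and inductively $\Gamma_{i+1}=\Gamma_{i+1,\varphi}=\Gamma^{\varphi_i}$ (the normal closure of $\varphi_i\colon\Gamma\to\Gamma_i$), $\varphi_{i+1}=c_{\varphi_i}\colon\Gamma\to\Gamma_{i+1}$, with normal map $\overline{\varphi_i}\colon\Gamma_{i+1}\to\Gamma_i$. Then $\Gamma_{\infty,\varphi}=\varprojlim\Gamma_{i,\varphi}$ is the inverse limit of $\cdots\to\Gamma_3\to\Gamma_2\to\Gamma_1=G$. For any other homomorphism, such as $\rho\colon\Gamma/\mathcal{K}\to G$, the tower $\{(\Gamma/\mathcal{K})_{i,\rho}\}$ and its inverse limit $(\Gamma/\mathcal{K})_{\infty,\rho}$ are defined in the same way. *)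

theory Defs
  imports "HOL-Algebra.Algebra"
begin

subsection \<open>Normal maps and normal closures\<close>

text \<open>A normal map (crossed module): \<open>act m g\<close> is the right action \<open>m\<^sup>g\<close>.\<close>

locale normal_map = group_hom M G n
  for M :: "('m, 'x) monoid_scheme" and G :: "('g, 'y) monoid_scheme" and n :: "'m \<Rightarrow> 'g" +
  fixes act :: "'m \<Rightarrow> 'g \<Rightarrow> 'm"
  assumes act_auto: "g \<in> carrier G \<Longrightarrow> (\<lambda>m. act m g) \<in> iso M M"
    and act_one: "m \<in> carrier M \<Longrightarrow> act m \<one>\<^bsub>G\<^esub> = m"
    and act_mult: "\<lbrakk>m \<in> carrier M; g \<in> carrier G; h \<in> carrier G\<rbrakk>
      \<Longrightarrow> act m (g \<otimes>\<^bsub>G\<^esub> h) = act (act m g) h"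
    and equivariant: "\<lbrakk>m \<in> carrier M; g \<in> carrier G\<rbrakk>
      \<Longrightarrow> n (act m g) = inv\<^bsub>G\<^esub> g \<otimes>\<^bsub>G\<^esub> n m \<otimes>\<^bsub>G\<^esub> g"
    and peiffer: "\<lbrakk>m \<in> carrier M; m' \<in> carrier M\<rbrakk>
      \<Longrightarrow> act m (n m') = inv\<^bsub>M\<^esub> m' \<otimes>\<^bsub>M\<^esub> m \<otimes>\<^bsub>M\<^esub> m'"

definition normal_morphism ::
  "('g, 'z) monoid_scheme \<Rightarrow>
   ('m, 'x) monoid_scheme \<Rightarrow> ('m \<Rightarrow> 'g) \<Rightarrow> ('m \<Rightarrow> 'g \<Rightarrow> 'm) \<Rightarrow>
   ('k, 'y) monoid_scheme \<Rightarrow> ('k \<Rightarrow> 'g) \<Rightarrow> ('k \<Rightarrow> 'g \<Rightarrow> 'k) \<Rightarrow> ('m \<Rightarrow> 'k) \<Rightarrow> bool" where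
  "normal_morphism G M n act M' n' act' \<mu> \<longleftrightarrow>
     \<mu> \<in> hom M M' \<and>
     (\<forall>m\<in>carrier M. n' (\<mu> m) = n m) \<and>
     (\<forall>m\<in>carrier M. \<forall>g\<in>carrier G. \<mu> (act m g) = act' (\<mu> m) g)"

text \<open>A factorization \<open>\<Gamma> \<rightarrow> M \<rightarrow> G\<close> of a homomorphism, with an action of \<open>G\<close> on \<open>M\<close>.\<close>

record ('a, 'g, 'm) factorization =
  middle :: "'m monoid"
  action :: "'m \<Rightarrow> 'g \<Rightarrow> 'm"
  into :: "'a \<Rightarrow> 'm"
  out :: "'m \<Rightarrow> 'g"

definition normal_factorization ::
  "'a monoid \<Rightarrow> 'g monoid \<Rightarrow> ('a \<Rightarrow> 'g) \<Rightarrow> ('a, 'g, 'm) factorization \<Rightarrow> bool" where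
  "normal_factorization \<Gamma> G \<phi> F \<longleftrightarrow>
     normal_map (middle F) G (out F) (action F) \<and>
     into F \<in> hom \<Gamma> (middle F) \<and>
     (\<forall>x\<in>carrier \<Gamma>. out F (into F x) = \<phi> x)"

text \<open>The universal property.  A formula cannot quantify over types, so the type over which the
  competing factorizations range is a parameter.  Functions are only constrained on carriers; hence
  uniqueness is among extensional functions.\<close>

definition is_normal_closure ::
  "'t itself \<Rightarrow> 'a monoid \<Rightarrow> 'g monoid \<Rightarrow> ('a \<Rightarrow> 'g) \<Rightarrow> ('a, 'g, 'm) factorization \<Rightarrow> bool" where
  "is_normal_closure _ \<Gamma> G \<phi> F \<longleftrightarrow>
     normal_factorization \<Gamma> G \<phi> F \<and>
     (\<forall>F' :: ('a, 'g, 't) factorization. normal_factorization \<Gamma> G \<phi> F' \<longrightarrow>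
        (\<exists>!u. u \<in> extensional (carrier (middle F)) \<and>
           normal_morphism G (middle F) (out F) (action F) (middle F') (out F') (action F') u \<and>
           (\<forall>x\<in>carrier \<Gamma>. u (into F x) = into F' x)))"

text \<open>One type that holds the whole tower of \<open>\<Gamma> \<rightarrow> G\<close>, for \<open>\<Gamma>\<close> over \<open>'a\<close> and \<open>G\<close> over \<open>'b\<close>: it contains
  a copy of \<open>'b\<close>, and it is closed under forming words in \<open>\<Gamma> \<times> H\<close> for groups \<open>H\<close> inside it, so that
  normal closures can be found in it again.\<close>

datatype ('a, 'b) tower_elem = Base 'b | Word (letters: "('a \<times> ('a, 'b) tower_elem) list")

text \<open>The normal closure is chosen by its universal property among groups of type
  \<open>tower_elem\<close>; \<open>normal_closure_universal\<close> below shows that it exists and that it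
  is universal among groups of every type.\<close>

definition normal_closure ::
  "'a monoid \<Rightarrow> ('a, 'b) tower_elem monoid \<Rightarrow> ('a \<Rightarrow> ('a, 'b) tower_elem)
     \<Rightarrow> ('a, ('a, 'b) tower_elem, ('a, 'b) tower_elem) factorization" where
  "normal_closure \<Gamma> G \<phi> =
     (SOME F. is_normal_closure TYPE(('a, 'b) tower_elem) \<Gamma> G \<phi> F)"

subsection \<open>The normal closures tower\<close>

text \<open>Indices start at 0 instead of 1: \<open>tower \<Gamma> G \<phi> i\<close> consists of \<open>\<Gamma>\<^bsub>i+1\<^esub>\<close> and
  \<open>\<phi>\<^bsub>i+1\<^esub> : \<Gamma> \<rightarrow> \<Gamma>\<^bsub>i+1\<^esub>\<close>.  The bottom group is the copy of \<open>G\<close> under the injection \<open>Base\<close>.\<close>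

primrec tower ::
  "'a monoid \<Rightarrow> 'b monoid \<Rightarrow> ('a \<Rightarrow> 'b) \<Rightarrow> nat
     \<Rightarrow> ('a, 'b) tower_elem monoid \<times> ('a \<Rightarrow> ('a, 'b) tower_elem)" where
  "tower \<Gamma> G \<phi> 0 = (image_group Base G, Base \<circ> \<phi>)"
| "tower \<Gamma> G \<phi> (Suc i) =
     (let F = normal_closure \<Gamma> (fst (tower \<Gamma> G \<phi> i)) (snd (tower \<Gamma> G \<phi> i))
      in (middle F, into F))"

definition tower_group ::
  "'a monoid \<Rightarrow> 'b monoid \<Rightarrow> ('a \<Rightarrow> 'b) \<Rightarrow> nat \<Rightarrow> ('a, 'b) tower_elem monoid" where
  "tower_group \<Gamma> G \<phi> i = fst (tower \<Gamma> G \<phi> i)"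

definition tower_hom ::
  "'a monoid \<Rightarrow> 'b monoid \<Rightarrow> ('a \<Rightarrow> 'b) \<Rightarrow> nat \<Rightarrow> 'a \<Rightarrow> ('a, 'b) tower_elem" where
  "tower_hom \<Gamma> G \<phi> i = snd (tower \<Gamma> G \<phi> i)"

definition tower_map ::
  "'a monoid \<Rightarrow> 'b monoid \<Rightarrow> ('a \<Rightarrow> 'b) \<Rightarrow> nat \<Rightarrow> ('a, 'b) tower_elem \<Rightarrow> ('a, 'b) tower_elem" where
  "tower_map \<Gamma> G \<phi> i = out (normal_closure \<Gamma> (tower_group \<Gamma> G \<phi> i) (tower_hom \<Gamma> G \<phi> i))"

definition inverse_limit :: "(nat \<Rightarrow> 'c monoid) \<Rightarrow> (nat \<Rightarrow> 'c \<Rightarrow> 'c) \<Rightarrow> (nat \<Rightarrow> 'c) monoid" where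
  "inverse_limit T p =
     \<lparr>carrier = {x. \<forall>i. x i \<in> carrier (T i) \<and> p i (x (Suc i)) = x i},
      monoid.mult = (\<lambda>x y i. x i \<otimes>\<^bsub>T i\<^esub> y i),
      monoid.one = (\<lambda>i. \<one>\<^bsub>T i\<^esub>)\<rparr>"

definition tower_limit ::
  "'a monoid \<Rightarrow> 'b monoid \<Rightarrow> ('a \<Rightarrow> 'b) \<Rightarrow> (nat \<Rightarrow> ('a, 'b) tower_elem) monoid" where
  "tower_limit \<Gamma> G \<phi> = inverse_limit (tower_group \<Gamma> G \<phi>) (tower_map \<Gamma> G \<phi>)"

subsection \<open>The relative lower central series\<close>

definition commutator_subgroup :: "('a, 'x) monoid_scheme \<Rightarrow> 'a set \<Rightarrow> 'a set \<Rightarrow> 'a set" where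
  "commutator_subgroup G H K =
     generate G (\<Union>h\<in>H. \<Union>k\<in>K. {h \<otimes>\<^bsub>G\<^esub> k \<otimes>\<^bsub>G\<^esub> inv\<^bsub>G\<^esub> h \<otimes>\<^bsub>G\<^esub> inv\<^bsub>G\<^esub> k})"

text \<open>Again indices start at 0: \<open>relative_series \<Gamma> K i\<close> is \<open>K\<^bsub>i+1\<^esub>\<close>.\<close>

primrec relative_series :: "('a, 'x) monoid_scheme \<Rightarrow> 'a set \<Rightarrow> nat \<Rightarrow> 'a set" where
  "relative_series \<Gamma> K 0 = K"
| "relative_series \<Gamma> K (Suc i) = commutator_subgroup \<Gamma> (carrier \<Gamma>) (relative_series \<Gamma> K i)"

definition terminal_member :: "(nat \<Rightarrow> 'a set) \<Rightarrow> 'a set \<Rightarrow> bool" where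
  "terminal_member H L \<longleftrightarrow> (\<exists>t. H t = L \<and> (\<forall>s\<ge>t. H s = H t))"

subsection \<open>Existence and universality of the normal closure\<close>

lemma (in normal_map) act_closed [simp]:
  assumes "m \<in> carrier M" "g \<in> carrier G" shows "act m g \<in> carrier M"
  using act_auto[OF assms(2)] assms(1) by (auto simp: iso_def hom_def)

lemma (in normal_map) act_prod:
  assumes "m \<in> carrier M" "m' \<in> carrier M" "g \<in> carrier G"
  shows "act (m \<otimes>\<^bsub>M\<^esub> m') g = act m g \<otimes>\<^bsub>M\<^esub> act m' g"
  using act_auto[OF assms(3)] assms(1,2) by (auto simp: iso_def hom_def)

lemma (in normal_map) act_unit:
  assumes "g \<in> carrier G"
  shows "act \<one>\<^bsub>M\<^esub> g = \<one>\<^bsub>M\<^esub>"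
proof -
  have "act (\<one>\<^bsub>M\<^esub> \<otimes>\<^bsub>M\<^esub> \<one>\<^bsub>M\<^esub>) g = act \<one>\<^bsub>M\<^esub> g \<otimes>\<^bsub>M\<^esub> act \<one>\<^bsub>M\<^esub> g"
    using assms by (intro act_prod) auto
  then show ?thesis
    using assms G.r_cancel_one[of "act \<one>\<^bsub>M\<^esub> g" "act \<one>\<^bsub>M\<^esub> g"] by simp
qed

lemma (in normal_map) swap:
  assumes "m \<in> carrier M" "m' \<in> carrier M"
  shows "m \<otimes>\<^bsub>M\<^esub> m' = m' \<otimes>\<^bsub>M\<^esub> act m (n m')"
  using assms by (simp add: peiffer G.m_assoc[symmetric])

text \<open>The letter \<open>(x, g)\<close> stands for \<open>c x\<close> acted on by \<open>g\<close>.  Inverses of letters are letters, so the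
  normal closure is a quotient of the monoid of words.\<close>

locale closure_construction = group_hom \<Gamma> G \<phi>
  for \<Gamma> :: "'a monoid" and G :: "('a, 'b) tower_elem monoid" and \<phi>
begin

definition "W = lists (carrier \<Gamma> \<times> carrier G)"

lemma W_simps [simp]:
  "[] \<in> W"
  "l # w \<in> W \<longleftrightarrow> l \<in> carrier \<Gamma> \<times> carrier G \<and> w \<in> W"
  "v @ w \<in> W \<longleftrightarrow> v \<in> W \<and> w \<in> W"
  by (auto simp: W_def)

abbreviation val1 :: "'a \<times> ('a, 'b) tower_elem \<Rightarrow> ('a, 'b) tower_elem" where
  "val1 l \<equiv> inv\<^bsub>G\<^esub> snd l \<otimes>\<^bsub>G\<^esub> \<phi> (fst l) \<otimes>\<^bsub>G\<^esub> snd l"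

primrec val :: "('a \<times> ('a, 'b) tower_elem) list \<Rightarrow> ('a, 'b) tower_elem" where
  "val [] = \<one>\<^bsub>G\<^esub>"
| "val (l # w) = val1 l \<otimes>\<^bsub>G\<^esub> val w"

abbreviation wact1 where "wact1 l k \<equiv> (fst l, snd l \<otimes>\<^bsub>G\<^esub> k)"

definition wact :: "('a \<times> ('a, 'b) tower_elem) list \<Rightarrow> ('a, 'b) tower_elem \<Rightarrow> ('a \<times> ('a, 'b) tower_elem) list" where
  "wact w k = map (\<lambda>l. wact1 l k) w"

inductive eqv (infix \<open>\<asymp>\<close> 50) where
  refl: "w \<in> W \<Longrightarrow> w \<asymp> w"
| sym: "v \<asymp> w \<Longrightarrow> w \<asymp> v"
| trans: "u \<asymp> v \<Longrightarrow> v \<asymp> w \<Longrightarrow> u \<asymp> w"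
| app: "u \<asymp> u' \<Longrightarrow> v \<asymp> v' \<Longrightarrow> u @ v \<asymp> u' @ v'"
| unit: "g \<in> carrier G \<Longrightarrow> [(\<one>\<^bsub>\<Gamma>\<^esub>, g)] \<asymp> []"
| mult: "x \<in> carrier \<Gamma> \<Longrightarrow> y \<in> carrier \<Gamma> \<Longrightarrow> g \<in> carrier G
    \<Longrightarrow> [(x, g), (y, g)] \<asymp> [(x \<otimes>\<^bsub>\<Gamma>\<^esub> y, g)]"
| peiffer: "k \<in> carrier \<Gamma> \<times> carrier G \<Longrightarrow> l \<in> carrier \<Gamma> \<times> carrier G
    \<Longrightarrow> [k, l] \<asymp> [l, wact1 k (val1 l)]"

lemma val1_closed [simp]: "l \<in> carrier \<Gamma> \<times> carrier G \<Longrightarrow> val1 l \<in> carrier G"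
  by auto

lemma val_closed [simp]: "w \<in> W \<Longrightarrow> val w \<in> carrier G"
  by (induction w) auto

lemma wact_closed [simp]: "w \<in> W \<Longrightarrow> k \<in> carrier G \<Longrightarrow> wact w k \<in> W"
  by (induction w) (auto simp: wact_def)

lemma eqv_W: "v \<asymp> w \<Longrightarrow> v \<in> W \<and> w \<in> W"
  by (induction rule: eqv.induct) (auto simp: mem_Times_iff)

lemma val_append [simp]: "v \<in> W \<Longrightarrow> w \<in> W \<Longrightarrow> val (v @ w) = val v \<otimes>\<^bsub>G\<^esub> val w"
  by (induction v) (auto simp: H.m_assoc)

lemma inv_cancel [simp]:
  "x \<in> carrier G \<Longrightarrow> y \<in> carrier G \<Longrightarrow> x \<otimes>\<^bsub>G\<^esub> (inv\<^bsub>G\<^esub> x \<otimes>\<^bsub>G\<^esub> y) = y"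
  "x \<in> carrier G \<Longrightarrow> y \<in> carrier G \<Longrightarrow> inv\<^bsub>G\<^esub> x \<otimes>\<^bsub>G\<^esub> (x \<otimes>\<^bsub>G\<^esub> y) = y"
  by (simp_all add: H.m_assoc[symmetric])

lemma val_wact: "w \<in> W \<Longrightarrow> k \<in> carrier G \<Longrightarrow> val (wact w k) = inv\<^bsub>G\<^esub> k \<otimes>\<^bsub>G\<^esub> val w \<otimes>\<^bsub>G\<^esub> k"
proof (induction w)
  case (Cons l w)
  then have "val (wact w k) = inv\<^bsub>G\<^esub> k \<otimes>\<^bsub>G\<^esub> val w \<otimes>\<^bsub>G\<^esub> k" by auto
  with Cons show ?case by (auto simp: wact_def H.m_assoc H.inv_mult_group)
qed (simp add: wact_def)

lemma val_eqv: "v \<asymp> w \<Longrightarrow> val v = val w"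
proof (induction rule: eqv.induct)
  case (app u u' v v')
  then show ?case using eqv_W by simp
next
  case (peiffer k l)
  then show ?case by (auto simp: H.m_assoc H.inv_mult_group)
qed (auto simp: H.m_assoc)

lemma wact_eqv: "v \<asymp> w \<Longrightarrow> k \<in> carrier G \<Longrightarrow> wact v k \<asymp> wact w k"
proof (induction rule: eqv.induct)
  case (peiffer a l)
  then obtain x g y h where [simp]: "a = (x, g)" "l = (y, h)"
    and c: "x \<in> carrier \<Gamma>" "y \<in> carrier \<Gamma>" "g \<in> carrier G" "h \<in> carrier G"
    by (cases a; cases l) auto
  have "[(x, g \<otimes>\<^bsub>G\<^esub> k), (y, h \<otimes>\<^bsub>G\<^esub> k)] \<asymp>
    [(y, h \<otimes>\<^bsub>G\<^esub> k), wact1 (x, g \<otimes>\<^bsub>G\<^esub> k) (val1 (y, h \<otimes>\<^bsub>G\<^esub> k))]"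
    using c peiffer.prems by (intro eqv.peiffer) auto
  then show ?case using c peiffer.prems
    by (simp add: wact_def H.m_assoc H.inv_mult_group)
next
  case (refl w)
  then show ?case by (intro eqv.refl wact_closed)
qed (auto simp: wact_def intro: eqv.intros)

lemma app_left: "u \<in> W \<Longrightarrow> v \<asymp> w \<Longrightarrow> u @ v \<asymp> u @ w"
  by (intro eqv.app eqv.refl)

lemma app_right: "u \<in> W \<Longrightarrow> v \<asymp> w \<Longrightarrow> v @ u \<asymp> w @ u"
  by (intro eqv.app eqv.refl)

lemma swap1:
  assumes "w \<in> W" "k \<in> carrier \<Gamma> \<times> carrier G"
  shows "k # w \<asymp> w @ [wact1 k (val w)]"
  using assms
proof (induction w arbitrary: k)
  case Nil
  then show ?case by (auto intro!: eqv.refl simp: mem_Times_iff)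
next
  case (Cons l w)
  then have l: "l \<in> carrier \<Gamma> \<times> carrier G" and w: "w \<in> W" by auto
  let ?k = "wact1 k (val1 l)"
  have k: "?k \<in> carrier \<Gamma> \<times> carrier G" using Cons.prems l by (auto simp: mem_Times_iff)
  have "[k, l] @ w \<asymp> [l, ?k] @ w"
    using Cons.prems l w by (intro app_right eqv.peiffer) auto
  moreover have "[l] @ (?k # w) \<asymp> [l] @ (w @ [wact1 ?k (val w)])"
    using l w k by (intro app_left Cons.IH) auto
  ultimately have "k # l # w \<asymp> l # w @ [wact1 ?k (val w)]"
    using eqv.trans by fastforce
  moreover have "wact1 ?k (val w) = wact1 k (val (l # w))"
    using Cons.prems l w by (auto simp: H.m_assoc mem_Times_iff)
  ultimately show ?case by simp
qed

lemma swap: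
  assumes "v \<in> W" "w \<in> W"
  shows "v @ w \<asymp> w @ wact v (val w)"
  using assms(1)
proof (induction v)
  case Nil
  then show ?case using assms by (auto intro: eqv.refl simp: wact_def)
next
  case (Cons k v)
  then have k: "k \<in> carrier \<Gamma> \<times> carrier G" and v: "v \<in> W" by auto
  have "[k] @ (v @ w) \<asymp> [k] @ (w @ wact v (val w))"
    using k v by (intro app_left Cons.IH) auto
  moreover have "(k # w) @ wact v (val w) \<asymp> (w @ [wact1 k (val w)]) @ wact v (val w)"
    using k v assms by (intro app_right swap1) auto
  ultimately show ?case using eqv.trans by (fastforce simp: wact_def)
qed

definition winv where "winv w = rev (map (\<lambda>l. (inv\<^bsub>\<Gamma>\<^esub> fst l, snd l)) w)"

lemma winv_closed [simp]: "w \<in> W \<Longrightarrow> winv w \<in> W"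
  by (induction w) (auto simp: winv_def)

lemma winv_eqv: "w \<in> W \<Longrightarrow> winv w @ w \<asymp> []"
proof (induction w)
  case Nil
  then show ?case by (simp add: winv_def eqv.refl)
next
  case (Cons l w)
  then obtain x g where [simp]: "l = (x, g)" and c: "x \<in> carrier \<Gamma>" "g \<in> carrier G" "w \<in> W"
    by (cases l) auto
  have "[(inv\<^bsub>\<Gamma>\<^esub> x, g), (x, g)] \<asymp> [(inv\<^bsub>\<Gamma>\<^esub> x \<otimes>\<^bsub>\<Gamma>\<^esub> x, g)]"
    using c by (intro eqv.mult) auto
  then have "[(inv\<^bsub>\<Gamma>\<^esub> x, g), (x, g)] \<asymp> []"
    using c eqv.unit eqv.trans by fastforce
  then have "winv w @ [(inv\<^bsub>\<Gamma>\<^esub> x, g), (x, g)] @ w \<asymp> winv w @ [] @ w"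
    using c by (intro app_left app_right) auto
  with Cons.IH c have "winv w @ [(inv\<^bsub>\<Gamma>\<^esub> x, g), (x, g)] @ w \<asymp> []"
    using eqv.trans by fastforce
  then show ?case by (simp add: winv_def)
qed

definition cls where "cls w = Word (SOME v. w \<asymp> v)"

lemma cls_letters: "w \<in> W \<Longrightarrow> w \<asymp> letters (cls w)"
  unfolding cls_def by (simp, rule someI[of _ w], rule eqv.refl)

lemma cls_eq: "v \<asymp> w \<Longrightarrow> cls v = cls w"
proof -
  assume "v \<asymp> w"
  then have "(\<lambda>u. v \<asymp> u) = (\<lambda>u. w \<asymp> u)" using eqv.sym eqv.trans by blast
  then show ?thesis by (simp add: cls_def)
qed

lemma cls_eqD: "v \<in> W \<Longrightarrow> w \<in> W \<Longrightarrow> cls v = cls w \<Longrightarrow> v \<asymp> w"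
  by (metis cls_letters eqv.sym eqv.trans)

definition E :: "('a, 'b) tower_elem monoid" where
  "E = \<lparr>carrier = cls ` W, monoid.mult = (\<lambda>a b. cls (letters a @ letters b)), monoid.one = cls []\<rparr>"

definition Eact where "Eact a k = cls (wact (letters a) k)"

definition EF :: "('a, ('a, 'b) tower_elem, ('a, 'b) tower_elem) factorization" where
  "EF = \<lparr>middle = E, action = Eact, into = (\<lambda>x. cls [(x, \<one>\<^bsub>G\<^esub>)]), out = (\<lambda>a. val (letters a))\<rparr>"

lemma E_carrier: "carrier E = cls ` W"
  by (simp add: E_def)

lemma E_one: "\<one>\<^bsub>E\<^esub> = cls []"
  by (simp add: E_def)

lemma cls_in [simp]: "w \<in> W \<Longrightarrow> cls w \<in> carrier E"
  by (auto simp: E_def)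

lemma E_mult: "v \<in> W \<Longrightarrow> w \<in> W \<Longrightarrow> cls v \<otimes>\<^bsub>E\<^esub> cls w = cls (v @ w)"
  by (simp add: E_def, rule cls_eq, intro eqv.app eqv.sym[OF cls_letters])

lemma E_act: "w \<in> W \<Longrightarrow> k \<in> carrier G \<Longrightarrow> Eact (cls w) k = cls (wact w k)"
  unfolding Eact_def by (intro cls_eq wact_eqv eqv.sym[OF cls_letters])

lemma E_val: "w \<in> W \<Longrightarrow> val (letters (cls w)) = val w"
  by (intro val_eqv eqv.sym[OF cls_letters])

lemma E_group: "group E"
proof (rule groupI)
  fix x assume "x \<in> carrier E"
  then obtain w where w: "w \<in> W" "x = cls w" by (auto simp: E_carrier)
  then have "cls (winv w) \<otimes>\<^bsub>E\<^esub> x = \<one>\<^bsub>E\<^esub>" by (simp add: E_mult E_one cls_eq winv_eqv)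
  then show "\<exists>y\<in>carrier E. y \<otimes>\<^bsub>E\<^esub> x = \<one>\<^bsub>E\<^esub>" using w by (intro bexI[of _ "cls (winv w)"]) auto
  show "\<one>\<^bsub>E\<^esub> \<otimes>\<^bsub>E\<^esub> x = x" using w by (simp add: E_one E_mult)
qed (auto simp: E_carrier E_mult E_one)

lemma wact_append: "wact (v @ w) k = wact v k @ wact w k"
  by (simp add: wact_def)

lemma wact_one: "w \<in> W \<Longrightarrow> wact w \<one>\<^bsub>G\<^esub> = w"
  by (induction w) (auto simp: wact_def)

lemma wact_mult: "w \<in> W \<Longrightarrow> g \<in> carrier G \<Longrightarrow> h \<in> carrier G
    \<Longrightarrow> wact w (g \<otimes>\<^bsub>G\<^esub> h) = wact (wact w g) h"
  by (induction w) (auto simp: wact_def H.m_assoc)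

lemma E_normal_map: "normal_map E G (\<lambda>a. val (letters a)) Eact"
proof -
  interpret E: group E by (rule E_group)
  have act: "Eact a g \<in> carrier E" "Eact a \<one>\<^bsub>G\<^esub> = a"
      "Eact a (g \<otimes>\<^bsub>G\<^esub> h) = Eact (Eact a g) h"
    if "a \<in> carrier E" "g \<in> carrier G" "h \<in> carrier G" for a g h
    using that by (auto simp: E_carrier E_act wact_one wact_mult)
  note act(2)[OF _ H.one_closed H.one_closed]
  note act = act(1)[OF _ _ H.one_closed] this act(3)
  have act_mult: "Eact (a \<otimes>\<^bsub>E\<^esub> b) g = Eact a g \<otimes>\<^bsub>E\<^esub> Eact b g"
    if "a \<in> carrier E" "b \<in> carrier E" "g \<in> carrier G" for a b g
    using that by (auto simp: E_carrier E_act E_mult wact_append)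
  show ?thesis
  proof unfold_locales
    show "(\<lambda>a. val (letters a)) \<in> hom E G"
      by (auto simp: hom_def E_carrier E_mult E_val)
  next
    fix g assume g: "g \<in> carrier G"
    have "bij_betw (\<lambda>a. Eact a g) (carrier E) (carrier E)"
    proof (rule bij_betw_byWitness[where f' = "\<lambda>a. Eact a (inv\<^bsub>G\<^esub> g)"])
      show "\<forall>a\<in>carrier E. Eact (Eact a g) (inv\<^bsub>G\<^esub> g) = a"
        using g act by (metis H.inv_closed H.r_inv)
      show "\<forall>a\<in>carrier E. Eact (Eact a (inv\<^bsub>G\<^esub> g)) g = a"
        using g act by (metis H.inv_closed H.l_inv)
    qed (use g act in auto)
    then show "(\<lambda>a. Eact a g) \<in> iso E E"
      using g act act_mult by (auto simp: iso_def hom_def)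
  next
    fix a b assume a: "a \<in> carrier E" and b: "b \<in> carrier E"
    then obtain v w where vw: "v \<in> W" "w \<in> W" "a = cls v" "b = cls w" by (auto simp: E_carrier)
    then have eq: "a \<otimes>\<^bsub>E\<^esub> b = b \<otimes>\<^bsub>E\<^esub> Eact a (val (letters b))"
      by (simp add: E_mult E_act E_val cls_eq swap)
    have "Eact a (val (letters b)) \<in> carrier E" using vw by (simp add: E_act E_val)
    then show "Eact a (val (letters b)) = inv\<^bsub>E\<^esub> b \<otimes>\<^bsub>E\<^esub> a \<otimes>\<^bsub>E\<^esub> b"
      using a b eq by (simp add: E.m_assoc, simp add: E.m_assoc[symmetric])
  next
    fix a g assume "a \<in> carrier E" "g \<in> carrier G"
    then show "val (letters (Eact a g)) = inv\<^bsub>G\<^esub> g \<otimes>\<^bsub>G\<^esub> val (letters a) \<otimes>\<^bsub>G\<^esub> g"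
      by (auto simp: E_carrier E_act E_val val_wact)
  qed (use act in auto)
qed

lemma EF_normal_factorization: "normal_factorization \<Gamma> G \<phi> EF"
proof -
  have "(\<lambda>x. cls [(x, \<one>\<^bsub>G\<^esub>)]) \<in> hom \<Gamma> E"
    by (auto simp: hom_def E_mult intro!: cls_eq eqv.sym[OF eqv.mult])
  then show ?thesis
    by (simp add: normal_factorization_def EF_def E_normal_map E_val)
qed

lemma EF_universal: "is_normal_closure TYPE('t) \<Gamma> G \<phi> EF"
  unfolding is_normal_closure_def
proof (intro conjI allI impI EF_normal_factorization)
  fix F :: "('a, ('a, 'b) tower_elem, 't) factorization"
  assume F: "normal_factorization \<Gamma> G \<phi> F"
  define M n act \<psi> where "M = middle F" "n = out F" "act = action F" "\<psi> = into F"
  note d = this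
  interpret M: normal_map M G n act using F by (simp add: normal_factorization_def d)
  have \<psi>: "\<psi> \<in> hom \<Gamma> M" "\<And>x. x \<in> carrier \<Gamma> \<Longrightarrow> n (\<psi> x) = \<phi> x"
    using F by (auto simp: normal_factorization_def d)
  then have \<psi>c [simp]: "\<And>x. x \<in> carrier \<Gamma> \<Longrightarrow> \<psi> x \<in> carrier M"
    and \<psi>m: "\<And>x y. x \<in> carrier \<Gamma> \<Longrightarrow> y \<in> carrier \<Gamma> \<Longrightarrow> \<psi> (x \<otimes>\<^bsub>\<Gamma>\<^esub> y) = \<psi> x \<otimes>\<^bsub>M\<^esub> \<psi> y"
    by (auto simp: hom_def)
  have \<psi>1: "\<psi> \<one>\<^bsub>\<Gamma>\<^esub> = \<one>\<^bsub>M\<^esub>" using Group.hom_one[OF \<psi>(1)] G.is_group M.G.is_group by simp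
  define ev where "ev w = foldr (\<lambda>l a. act (\<psi> (fst l)) (snd l) \<otimes>\<^bsub>M\<^esub> a) w \<one>\<^bsub>M\<^esub>" for w
  have ev_Nil: "ev [] = \<one>\<^bsub>M\<^esub>" and ev_Cons: "ev (l # w) = act (\<psi> (fst l)) (snd l) \<otimes>\<^bsub>M\<^esub> ev w" for l w
    by (simp_all add: ev_def)
  have evc [simp]: "ev w \<in> carrier M" if "w \<in> W" for w
    using that by (induction w) (auto simp: ev_Nil ev_Cons)
  have ev_app: "ev (v @ w) = ev v \<otimes>\<^bsub>M\<^esub> ev w" if "v \<in> W" "w \<in> W" for v w
    using that by (induction v) (auto simp: ev_Nil ev_Cons M.G.m_assoc)
  have ev_act: "ev (wact w k) = act (ev w) k" if "w \<in> W" "k \<in> carrier G" for w k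
    using that
    by (induction w) (auto simp: ev_Nil ev_Cons wact_def M.act_unit M.act_prod M.act_mult)
  have ev_val: "n (ev w) = val w" if "w \<in> W" for w
    using that by (induction w) (auto simp: ev_Nil ev_Cons M.equivariant \<psi>(2))
  have ev_eqv: "ev v = ev w" if "v \<asymp> w" for v w
    using that
  proof (induction rule: eqv.induct)
    case (app u u' v v')
    then show ?case using eqv_W by (simp add: ev_app)
  next
    case (peiffer k l)
    then obtain x g y h where [simp]: "k = (x, g)" "l = (y, h)"
      and c: "x \<in> carrier \<Gamma>" "y \<in> carrier \<Gamma>" "g \<in> carrier G" "h \<in> carrier G"
      by (cases k; cases l) auto
    have "n (act (\<psi> y) h) = val1 l" using c by (simp add: M.equivariant \<psi>(2))
    then show ?case
      using c M.swap[of "act (\<psi> x) g" "act (\<psi> y) h"]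
      by (simp add: ev_Nil ev_Cons M.act_mult)
  qed (auto simp: ev_Nil ev_Cons \<psi>1 \<psi>m M.act_unit M.act_prod)
  define u where "u = restrict (\<lambda>a. ev (letters a)) (carrier E)"
  have u: "u (cls w) = ev w" if "w \<in> W" for w
    using that by (simp add: u_def ev_eqv[OF eqv.sym[OF cls_letters]])
  let ?P = "\<lambda>u. u \<in> extensional (carrier (middle EF)) \<and>
     normal_morphism G (middle EF) (out EF) (action EF) (middle F) (out F) (action F) u \<and>
     (\<forall>x\<in>carrier \<Gamma>. u (into EF x) = into F x)"
  have P: "?P v \<longleftrightarrow> v \<in> extensional (carrier E) \<and> v \<in> hom E M \<and>
      (\<forall>w\<in>W. n (v (cls w)) = val w) \<and>
      (\<forall>w\<in>W. \<forall>g\<in>carrier G. v (cls (wact w g)) = act (v (cls w)) g) \<and>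
      (\<forall>x\<in>carrier \<Gamma>. v (cls [(x, \<one>\<^bsub>G\<^esub>)]) = \<psi> x)" for v
    by (simp add: normal_morphism_def EF_def E_carrier E_val E_act d[symmetric] conj_assoc)
  show "\<exists>!u. ?P u"
  proof (rule ex1I[of _ u])
    have "u \<in> hom E M"
      by (auto simp: hom_def E_carrier u E_mult ev_app)
    then show "?P u"
      unfolding P
      by (auto simp: u ev_val ev_act ev_Nil ev_Cons M.act_one) (simp add: u_def)
  next
    fix v assume "?P v"
    then have ext: "v \<in> extensional (carrier E)" and hom: "v \<in> hom E M"
      and va: "\<And>w g. w \<in> W \<Longrightarrow> g \<in> carrier G \<Longrightarrow> v (cls (wact w g)) = act (v (cls w)) g"
      and vc: "\<And>x. x \<in> carrier \<Gamma> \<Longrightarrow> v (cls [(x, \<one>\<^bsub>G\<^esub>)]) = \<psi> x"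
      unfolding P by auto
    have "v (cls w) = ev w" if "w \<in> W" for w
      using that
    proof (induction w)
      case Nil
      then show ?case using Group.hom_one[OF hom E_group M.G.is_group] by (simp add: E_one ev_Nil)
    next
      case (Cons l w)
      then obtain x g where [simp]: "l = (x, g)" and c: "x \<in> carrier \<Gamma>" "g \<in> carrier G" "w \<in> W"
        by (cases l) auto
      have "v (cls [l]) = act (\<psi> x) g"
        using va[of "[(x, \<one>\<^bsub>G\<^esub>)]" g] vc[of x] c by (simp add: wact_def)
      moreover have "v (cls (l # w)) = v (cls [l]) \<otimes>\<^bsub>M\<^esub> v (cls w)"
        using Group.hom_mult[OF hom, of "cls [l]" "cls w"] c by (simp add: E_mult)
      ultimately show ?case using Cons.IH c by (simp add: ev_Cons)
    qed
    moreover have "u \<in> extensional (carrier E)" by (simp add: u_def)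
    ultimately show "v = u"
      using ext by (intro extensionalityI[of _ "carrier E"]) (auto simp: E_carrier u)
  qed
qed

end

lemma normal_morphism_comp:
  assumes "normal_morphism G M n act M' n' act' u" "normal_morphism G M' n' act' M'' n'' act'' v"
  shows "normal_morphism G M n act M'' n'' act'' (\<lambda>x. v (u x))"
  using assms by (auto simp: normal_morphism_def hom_def Pi_def)

lemma (in normal_map) normal_morphism_restrict:
  assumes "normal_morphism G M n act M' n' act' u"
  shows "normal_morphism G M n act M' n' act' (restrict u (carrier M))"
  using assms by (auto simp: normal_morphism_def hom_def)

lemma normal_closure_map:
  fixes F' :: "('a, 'g, 't) factorization"
  assumes "is_normal_closure TYPE('t) \<Gamma> G \<phi> F" "normal_factorization \<Gamma> G \<phi> F'"
  obtains u where "normal_morphism G (middle F) (out F) (action F) (middle F') (out F') (action F') u"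
    "\<And>x. x \<in> carrier \<Gamma> \<Longrightarrow> u (into F x) = into F' x"
  using assms unfolding is_normal_closure_def by blast

lemma normal_closure_unique:
  fixes F' :: "('a, 'g, 't) factorization"
  assumes F: "is_normal_closure TYPE('t) \<Gamma> G \<phi> F" and F': "normal_factorization \<Gamma> G \<phi> F'"
    and u: "normal_morphism G (middle F) (out F) (action F) (middle F') (out F') (action F') u"
      "\<And>x. x \<in> carrier \<Gamma> \<Longrightarrow> u (into F x) = into F' x"
    and v: "normal_morphism G (middle F) (out F) (action F) (middle F') (out F') (action F') v"
      "\<And>x. x \<in> carrier \<Gamma> \<Longrightarrow> v (into F x) = into F' x"
    and a: "a \<in> carrier (middle F)"
  shows "u a = v a"
proof -
  have "normal_factorization \<Gamma> G \<phi> F" using F by (simp add: is_normal_closure_def)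
  then interpret normal_map "middle F" G "out F" "action F"
    by (simp add: normal_factorization_def)
  have into: "into F x \<in> carrier (middle F)" if "x \<in> carrier \<Gamma>" for x
    using that \<open>normal_factorization \<Gamma> G \<phi> F\<close> by (auto simp: normal_factorization_def hom_def)
  have "restrict u (carrier (middle F)) = restrict v (carrier (middle F))"
    using F F' normal_morphism_restrict[OF u(1)] normal_morphism_restrict[OF v(1)] u(2) v(2) into
    unfolding is_normal_closure_def by (metis (no_types, lifting) restrict_apply restrict_extensional)
  then show ?thesis using a by (metis restrict_apply')
qed

text \<open>A factorization that is universal among groups of type \<open>tower_elem\<close> is universal among groups
  of every type.\<close>

lemma is_normal_closure_any_type:
  fixes \<Gamma> :: "'a monoid" and G :: "('a, 'b) tower_elem monoid"
    and F :: "('a, ('a, 'b) tower_elem, ('a, 'b) tower_elem) factorization"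
  assumes hom: "group_hom \<Gamma> G \<phi>" and F: "is_normal_closure TYPE(('a, 'b) tower_elem) \<Gamma> G \<phi> F"
  shows "is_normal_closure TYPE('t) \<Gamma> G \<phi> F"
  unfolding is_normal_closure_def
proof (intro conjI allI impI)
  interpret closure_construction \<Gamma> G \<phi> using hom by (simp add: closure_construction_def)
  show NF: "normal_factorization \<Gamma> G \<phi> F" using F by (simp add: is_normal_closure_def)
  then interpret N: normal_map "middle F" G "out F" "action F"
    by (simp add: normal_factorization_def)
  fix F' :: "('a, ('a, 'b) tower_elem, 't) factorization"
  assume F': "normal_factorization \<Gamma> G \<phi> F'"
  note E = EF_universal[where 't = 't] EF_universal[where 't = "('a, 'b) tower_elem"]
  have into: "into F x \<in> carrier (middle F)" if "x \<in> carrier \<Gamma>" for x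
    using that NF by (auto simp: normal_factorization_def hom_def)
  obtain a where a: "normal_morphism G (middle F) (out F) (action F) (middle EF) (out EF) (action EF) a"
      "\<And>x. x \<in> carrier \<Gamma> \<Longrightarrow> a (into F x) = into EF x"
    using normal_closure_map[OF F EF_normal_factorization] by metis
  obtain b where b: "normal_morphism G (middle EF) (out EF) (action EF) (middle F) (out F) (action F) b"
      "\<And>x. x \<in> carrier \<Gamma> \<Longrightarrow> b (into EF x) = into F x"
    using normal_closure_map[OF E(2) NF] by metis
  obtain c where c: "normal_morphism G (middle EF) (out EF) (action EF) (middle F') (out F') (action F') c"
      "\<And>x. x \<in> carrier \<Gamma> \<Longrightarrow> c (into EF x) = into F' x"
    using normal_closure_map[OF E(1) F'] by metis
  have id: "normal_morphism G (middle F) (out F) (action F) (middle F) (out F) (action F) (\<lambda>x. x)"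
    by (simp add: normal_morphism_def hom_def)
  have ba: "b (a x) = x" if "x \<in> carrier (middle F)" for x
    using normal_closure_unique[OF F NF normal_morphism_comp[OF a(1) b(1)] _ id _ that] a(2) b(2)
    by simp
  have ac: "a x \<in> carrier (middle EF)" if "x \<in> carrier (middle F)" for x
    using a(1) that by (auto simp: normal_morphism_def hom_def)
  let ?P = "\<lambda>u. u \<in> extensional (carrier (middle F)) \<and>
     normal_morphism G (middle F) (out F) (action F) (middle F') (out F') (action F') u \<and>
     (\<forall>x\<in>carrier \<Gamma>. u (into F x) = into F' x)"
  show "\<exists>!u. ?P u"
  proof (rule ex_ex1I)
    have "?P (restrict (\<lambda>x. c (a x)) (carrier (middle F)))"
      using N.normal_morphism_restrict[OF normal_morphism_comp[OF a(1) c(1)]] a(2) c(2) into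
      by simp
    then show "\<exists>u. ?P u" by blast
  next
    fix u v assume u: "?P u" and v: "?P v"
    show "u = v"
    proof (rule extensionalityI[of _ "carrier (middle F)"])
      fix x assume x: "x \<in> carrier (middle F)"
      have "u (b (a x)) = v (b (a x))"
        using normal_closure_unique[OF E(1) F' normal_morphism_comp[OF b(1), of _ _ _ u] _
          normal_morphism_comp[OF b(1), of _ _ _ v] _ ac[OF x]] u v b(2) by simp
      then show "u x = v x" using ba[OF x] by simp
    qed (use u v in auto)
  qed
qed

theorem normal_closure_universal:
  assumes "group_hom \<Gamma> G \<phi>"
  shows "is_normal_closure TYPE('t) \<Gamma> G \<phi> (normal_closure \<Gamma> G \<phi>)"
proof (rule is_normal_closure_any_type[OF assms])
  interpret closure_construction \<Gamma> G \<phi> using assms by (simp add: closure_construction_def)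
  show "is_normal_closure TYPE(('a, 'b) tower_elem) \<Gamma> G \<phi> (normal_closure \<Gamma> G \<phi>)"
    unfolding normal_closure_def by (rule someI[where P = "is_normal_closure TYPE(('a, 'b) tower_elem) \<Gamma> G \<phi>"], rule EF_universal)
qed

lemma tower_bottom:
  "Base \<in> iso G (tower_group \<Gamma> G \<phi> 0)" "tower_hom \<Gamma> G \<phi> 0 x = Base (\<phi> x)"
  by (simp_all add: tower_group_def tower_hom_def inj_imp_image_group_iso inj_on_def)

lemma tower_group_hom:
  assumes "group_hom \<Gamma> G \<phi>"
  shows "group_hom \<Gamma> (tower_group \<Gamma> G \<phi> i) (tower_hom \<Gamma> G \<phi> i)"
proof (induction i)
  case 0
  interpret group_hom \<Gamma> G \<phi> by (rule assms)
  have iso: "Base \<in> iso G (image_group Base G)"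
    by (rule inj_imp_image_group_iso) (simp add: inj_on_def)
  have "group (image_group Base G)"
    by (rule H.inj_imp_image_group_is_group) (simp add: inj_on_def)
  then show ?case
    using iso Group.hom_compose[OF homh, of Base "image_group Base G"]
    by (auto simp: group_hom_def group_hom_axioms_def tower_group_def tower_hom_def
        iso_def o_def)
next
  case (Suc i)
  let ?F = "normal_closure \<Gamma> (tower_group \<Gamma> G \<phi> i) (tower_hom \<Gamma> G \<phi> i)"
  have "normal_factorization \<Gamma> (tower_group \<Gamma> G \<phi> i) (tower_hom \<Gamma> G \<phi> i) ?F"
    using normal_closure_universal[OF Suc] by (auto simp: is_normal_closure_def)
  then show ?case
    using assms
    by (auto simp: normal_factorization_def normal_map_def group_hom_def group_hom_axioms_def
        tower_group_def tower_hom_def Let_def)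
qed

text \<open>Each group of the tower is the normal closure of the homomorphism to the previous one.\<close>

theorem tower_step:
  assumes "group_hom \<Gamma> G \<phi>"
  obtains act where "is_normal_closure TYPE('t) \<Gamma> (tower_group \<Gamma> G \<phi> i) (tower_hom \<Gamma> G \<phi> i)
    \<lparr>middle = tower_group \<Gamma> G \<phi> (Suc i), action = act,
     into = tower_hom \<Gamma> G \<phi> (Suc i), out = tower_map \<Gamma> G \<phi> i\<rparr>"
proof
  let ?F = "normal_closure \<Gamma> (tower_group \<Gamma> G \<phi> i) (tower_hom \<Gamma> G \<phi> i)"
  have "\<lparr>middle = tower_group \<Gamma> G \<phi> (Suc i), action = action ?F,
     into = tower_hom \<Gamma> G \<phi> (Suc i), out = tower_map \<Gamma> G \<phi> i\<rparr> = ?F"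
    by (simp add: tower_group_def tower_hom_def tower_map_def Let_def)
  then show "is_normal_closure TYPE('t) \<Gamma> (tower_group \<Gamma> G \<phi> i) (tower_hom \<Gamma> G \<phi> i)
    \<lparr>middle = tower_group \<Gamma> G \<phi> (Suc i), action = action ?F,
     into = tower_hom \<Gamma> G \<phi> (Suc i), out = tower_map \<Gamma> G \<phi> i\<rparr>"
    using normal_closure_universal[OF tower_group_hom[OF assms]] by simp
qed

end

theory Submission
  imports Defs
begin

text \<open>The kernel of a normal map is central: for \<open>n m' = 1\<close> the Peiffer identity says that \<open>m'\<close>
  commutes with everything.  Hence, if \<open>\<Gamma> \<rightarrow> \<Gamma>\<^sub>i\<close> kills a subgroup \<open>L\<close>, then \<open>\<Gamma> \<rightarrow> \<Gamma>\<^sub>i\<^sub>+\<^sub>1\<close> maps \<open>L\<close> into the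
  centre and kills \<open>[\<Gamma>, L]\<close> (\<open>normal_factorization_kills_commutators\<close>).  The terminal member \<open>\<K>\<close>
  satisfies \<open>\<K> = [\<Gamma>, \<K>]\<close> and is killed by \<open>\<phi>\<close>, so by induction it is killed at every level of the
  tower (\<open>tower_hom_kills_stable\<close>).

  Therefore every normal closure in the tower of \<open>\<phi>\<close> factors through \<open>\<Gamma>/\<K>\<close>.  A normal closure of
  \<open>\<Gamma> \<rightarrow> \<Gamma>\<^sub>i\<close> through which \<open>\<Gamma>/\<K>\<close> maps is also the normal closure of \<open>\<Gamma>/\<K> \<rightarrow> \<Gamma>\<^sub>i\<close>: both have the same
  universal property, because homomorphisms out of \<open>\<Gamma>/\<K>\<close> are homomorphisms out of \<open>\<Gamma>\<close> that kill \<open>\<K>\<close>.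
  So the two towers agree level by level.  As each tower is built from the chosen closures below it,
  they agree only up to isomorphism, and the comparison of closures (\<open>normal_closure_cong\<close>) has to
  allow isomorphic but different base groups.  The resulting isomorphisms commute with the maps of
  the towers, hence induce an isomorphism of inverse limits (\<open>inverse_limit_iso\<close>).\<close>

section \<open>Transport of normal maps along an isomorphism of the bases\<close>

lemma (in normal_map) transport_base:
  assumes \<theta>: "group_hom G G' \<theta>" and \<eta>: "group_hom G' G \<eta>"
    and \<eta>\<theta>: "\<And>g. g \<in> carrier G \<Longrightarrow> \<eta> (\<theta> g) = g"
    and \<theta>\<eta>: "\<And>g. g \<in> carrier G' \<Longrightarrow> \<theta> (\<eta> g) = g"
  shows "normal_map M G' (\<lambda>m. \<theta> (n m)) (\<lambda>m g. act m (\<eta> g))"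
proof -
  interpret \<theta>: group_hom G G' \<theta> by (rule \<theta>)
  interpret \<eta>: group_hom G' G \<eta> by (rule \<eta>)
  show ?thesis
  proof unfold_locales
    show "(\<lambda>m. \<theta> (n m)) \<in> hom M G'"
      by (auto simp: hom_def)
  qed (use act_auto act_one act_mult in \<open>auto simp: equivariant peiffer \<eta>\<theta> \<theta>\<eta>\<close>)
qed

section \<open>Comparison of normal closures\<close>

text \<open>This turns competitors over one base into competitors over the other, so that each of two
  universal properties can be applied to the other closure.\<close>

lemma normal_factorization_pullback:
  assumes F: "normal_factorization \<Gamma>' G' \<phi>' F"
    and \<theta>: "group_hom G G' \<theta>" and \<eta>: "group_hom G' G \<eta>"
    and \<eta>\<theta>: "\<And>g. g \<in> carrier G \<Longrightarrow> \<eta> (\<theta> g) = g"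
    and \<theta>\<eta>: "\<And>g. g \<in> carrier G' \<Longrightarrow> \<theta> (\<eta> g) = g"
    and \<psi>: "\<psi> \<in> hom \<Gamma> (middle F)" "\<And>x. x \<in> carrier \<Gamma> \<Longrightarrow> \<eta> (out F (\<psi> x)) = \<phi> x"
  shows "normal_factorization \<Gamma> G \<phi>
    \<lparr>middle = middle F, action = (\<lambda>m g. action F m (\<theta> g)), into = \<psi>, out = (\<lambda>m. \<eta> (out F m))\<rparr>"
  using normal_map.transport_base[OF _ \<eta> \<theta> \<theta>\<eta> \<eta>\<theta>, of "middle F" "out F" "action F"] F \<psi>
  by (simp add: normal_factorization_def)

text \<open>The usual argument that universal objects are isomorphic, with two twists.  The base group
  changes along \<open>\<theta>\<close>, and the source changes along the quotient map \<open>q\<close>: the hypothesis on fibres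
  says that \<open>into F\<close> descends to \<open>\<Gamma>'\<close>, which makes \<open>F\<close> a competitor for \<open>F'\<close>.  The two closures may
  live in different types, and each is mapped both to itself and to the other; hence universality
  is assumed at both types.\<close>

lemma normal_closure_cong:
  fixes F :: "('a, 'g, 'm) factorization" and F' :: "('c, 'h, 'k) factorization"
  assumes F: "is_normal_closure TYPE('m) \<Gamma> G \<phi> F" "is_normal_closure TYPE('k) \<Gamma> G \<phi> F"
    and F': "is_normal_closure TYPE('m) \<Gamma>' G' \<phi>' F'" "is_normal_closure TYPE('k) \<Gamma>' G' \<phi>' F'"
    and q: "group_hom \<Gamma> \<Gamma>' q" "q ` carrier \<Gamma> = carrier \<Gamma>'"
    and \<theta>: "\<theta> \<in> iso G G'"
    and square: "\<And>x. x \<in> carrier \<Gamma> \<Longrightarrow> \<phi>' (q x) = \<theta> (\<phi> x)"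
    and fibres: "\<And>x y. x \<in> carrier \<Gamma> \<Longrightarrow> y \<in> carrier \<Gamma> \<Longrightarrow> q x = q y \<Longrightarrow> into F x = into F y"
  obtains u where "u \<in> iso (middle F) (middle F')"
    "\<And>m. m \<in> carrier (middle F) \<Longrightarrow> out F' (u m) = \<theta> (out F m)"
    "\<And>x. x \<in> carrier \<Gamma> \<Longrightarrow> u (into F x) = into F' (q x)"
proof -
  have NF: "normal_factorization \<Gamma> G \<phi> F" and NF': "normal_factorization \<Gamma>' G' \<phi>' F'"
    using F F' by (auto simp: is_normal_closure_def)
  interpret N: normal_map "middle F" G "out F" "action F"
    using NF by (simp add: normal_factorization_def)
  interpret N': normal_map "middle F'" G' "out F'" "action F'"
    using NF' by (simp add: normal_factorization_def)
  interpret q: group_hom \<Gamma> \<Gamma>' q by (rule q)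
  have intoF: "into F \<in> hom \<Gamma> (middle F)" "\<And>x. x \<in> carrier \<Gamma> \<Longrightarrow> out F (into F x) = \<phi> x"
    and intoF': "into F' \<in> hom \<Gamma>' (middle F')" "\<And>x. x \<in> carrier \<Gamma>' \<Longrightarrow> out F' (into F' x) = \<phi>' x"
    using NF NF' by (auto simp: normal_factorization_def)
  define \<eta> where "\<eta> = inv_into (carrier G) \<theta>"
  have \<eta>: "\<eta> \<in> iso G' G"
    using N.H.iso_set_sym[OF \<theta>] by (simp add: \<eta>_def)
  have \<eta>\<theta>: "\<eta> (\<theta> g) = g" if "g \<in> carrier G" for g
    using \<theta> that by (auto simp: \<eta>_def iso_def bij_betw_def)
  have \<theta>\<eta>: "\<theta> (\<eta> g) = g" if "g \<in> carrier G'" for g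
    using \<theta> that by (auto simp: \<eta>_def iso_def bij_betw_def f_inv_into_f)
  have gh: "group_hom G G' \<theta>" "group_hom G' G \<eta>"
    using \<theta> \<eta> by (auto simp: group_hom_def group_hom_axioms_def iso_def
        N.H.group_axioms N'.H.group_axioms)
  interpret \<theta>: group_hom G G' \<theta> by (rule gh)
  interpret \<eta>: group_hom G' G \<eta> by (rule gh)
  have \<phi>c: "\<phi> x \<in> carrier G" if "x \<in> carrier \<Gamma>" for x
    using that intoF by (metis N.hom_closed hom_in_carrier)

  have "normal_factorization \<Gamma> G \<phi> \<lparr>middle = middle F', action = (\<lambda>m g. action F' m (\<theta> g)),
      into = (\<lambda>x. into F' (q x)), out = (\<lambda>m. \<eta> (out F' m))\<rparr>"
  proof (rule normal_factorization_pullback[OF NF' gh \<eta>\<theta> \<theta>\<eta>])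
    show "(\<lambda>x. into F' (q x)) \<in> hom \<Gamma> (middle F')"
      using intoF' by (auto simp: hom_def)
  qed (auto simp: intoF' square \<eta>\<theta> \<phi>c)
  from normal_closure_map[OF F(2) this] obtain u
    where u0: "normal_morphism G (middle F) (out F) (action F) (middle F')
        (\<lambda>m. \<eta> (out F' m)) (\<lambda>m g. action F' m (\<theta> g)) u"
      and uq: "\<And>x. x \<in> carrier \<Gamma> \<Longrightarrow> u (into F x) = into F' (q x)"
    by auto
  have u: "u \<in> hom (middle F) (middle F')"
    "\<And>m g. m \<in> carrier (middle F) \<Longrightarrow> g \<in> carrier G \<Longrightarrow> u (action F m g) = action F' (u m) (\<theta> g)"
    using u0 by (auto simp: normal_morphism_def)
  have uc: "u m \<in> carrier (middle F')" if "m \<in> carrier (middle F)" for m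
    using u(1) that by (rule hom_in_carrier)
  have uo: "out F' (u m) = \<theta> (out F m)" if "m \<in> carrier (middle F)" for m
  proof -
    have "\<eta> (out F' (u m)) = out F m"
      using u0 that by (simp add: normal_morphism_def)
    then show ?thesis using \<theta>\<eta>[of "out F' (u m)"] uc[OF that] by simp
  qed

  \<comment> \<open>A section of \<open>q\<close>; it need not be a homomorphism, but \<open>into F \<circ> s\<close> is, as \<open>into F\<close> is constant on the
    fibres of \<open>q\<close>.\<close>
  define s where "s = inv_into (carrier \<Gamma>) q"
  have s: "s y \<in> carrier \<Gamma>" "q (s y) = y" if "y \<in> carrier \<Gamma>'" for y
    using that q(2) by (auto simp: s_def inv_into_into f_inv_into_f)
  have sq: "into F (s (q x)) = into F x" if "x \<in> carrier \<Gamma>" for x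
    using that s by (intro fibres) auto
  have "normal_factorization \<Gamma>' G' \<phi>' \<lparr>middle = middle F, action = (\<lambda>m g. action F m (\<eta> g)),
      into = (\<lambda>y. into F (s y)), out = (\<lambda>m. \<theta> (out F m))\<rparr>"
  proof (rule normal_factorization_pullback[OF NF gh(2,1) \<theta>\<eta> \<eta>\<theta>])
    show "(\<lambda>y. into F (s y)) \<in> hom \<Gamma>' (middle F)"
    proof (rule homI)
      fix x y assume c: "x \<in> carrier \<Gamma>'" "y \<in> carrier \<Gamma>'"
      then have "into F (s (x \<otimes>\<^bsub>\<Gamma>'\<^esub> y)) = into F (s x \<otimes>\<^bsub>\<Gamma>\<^esub> s y)"
        using s by (intro fibres) auto
      then show "into F (s (x \<otimes>\<^bsub>\<Gamma>'\<^esub> y)) = into F (s x) \<otimes>\<^bsub>middle F\<^esub> into F (s y)"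
        using c s intoF by (auto simp: hom_def)
    qed (use s intoF in \<open>auto simp: hom_def\<close>)
    show "\<theta> (out F (into F (s x))) = \<phi>' x" if "x \<in> carrier \<Gamma>'" for x
      using that s[OF that] by (simp add: intoF square[symmetric])
  qed auto
  from normal_closure_map[OF F'(1) this] obtain v
    where v0: "normal_morphism G' (middle F') (out F') (action F') (middle F)
        (\<lambda>m. \<theta> (out F m)) (\<lambda>m g. action F m (\<eta> g)) v"
      and vq: "\<And>y. y \<in> carrier \<Gamma>' \<Longrightarrow> v (into F' y) = into F (s y)"
    by auto

  have v: "v \<in> hom (middle F') (middle F)"
    "\<And>m. m \<in> carrier (middle F') \<Longrightarrow> \<theta> (out F (v m)) = out F' m"
    "\<And>m g. m \<in> carrier (middle F') \<Longrightarrow> g \<in> carrier G' \<Longrightarrow> v (action F' m g) = action F (v m) (\<eta> g)"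
    using v0 by (auto simp: normal_morphism_def)
  have vc: "v m \<in> carrier (middle F)" if "m \<in> carrier (middle F')" for m
    using v(1) that by (rule hom_in_carrier)
  have vo: "out F (v m) = \<eta> (out F' m)" if "m \<in> carrier (middle F')" for m
    using that \<eta>\<theta>[of "out F (v m)"] by (simp add: v(2) vc)

  have vu_nm: "normal_morphism G (middle F) (out F) (action F) (middle F) (out F) (action F) (\<lambda>m. v (u m))"
    using Group.hom_compose[OF u(1) v(1)]
    by (simp add: normal_morphism_def o_def u v(3) uc uo vo \<eta>\<theta>)
  have id_nm: "normal_morphism G (middle F) (out F) (action F) (middle F) (out F) (action F) (\<lambda>m. m)"
    by (simp add: normal_morphism_def hom_def)
  have vu: "v (u m) = m" if "m \<in> carrier (middle F)" for m
    by (rule normal_closure_unique[OF F(1) NF vu_nm _ id_nm _ that]) (simp_all add: uq vq sq)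
  have uv_nm: "normal_morphism G' (middle F') (out F') (action F') (middle F') (out F') (action F') (\<lambda>m. u (v m))"
    using Group.hom_compose[OF v(1) u(1)]
    by (simp add: normal_morphism_def o_def u(2) v vc uo \<theta>\<eta>)
  have id_nm': "normal_morphism G' (middle F') (out F') (action F') (middle F') (out F') (action F') (\<lambda>m. m)"
    by (simp add: normal_morphism_def hom_def)
  have uv: "u (v m) = m" if "m \<in> carrier (middle F')" for m
    by (rule normal_closure_unique[OF F'(2) NF' uv_nm _ id_nm' _ that]) (simp_all add: uq vq s)
  have "bij_betw u (carrier (middle F)) (carrier (middle F'))"
    using vu uv uc vc by (intro bij_betw_byWitness[where f' = v]) auto
  then have "u \<in> iso (middle F) (middle F')"
    using u(1) by (simp add: iso_def)
  then show thesis using that uo uq by blast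
qed

section \<open>The terminal member dies in the tower\<close>

text \<open>\<open>into F\<close> sends \<open>N\<close> into the kernel of \<open>out F\<close>, which is central by the Peiffer identity.\<close>

lemma normal_factorization_kills_commutators:
  assumes \<Gamma>: "group \<Gamma>" and F: "normal_factorization \<Gamma> G \<phi> F"
    and N: "N \<subseteq> carrier \<Gamma>" "\<And>x. x \<in> N \<Longrightarrow> \<phi> x = \<one>\<^bsub>G\<^esub>"
    and x: "x \<in> commutator_subgroup \<Gamma> (carrier \<Gamma>) N"
  shows "into F x = \<one>\<^bsub>middle F\<^esub>"
proof -
  interpret M: normal_map "middle F" G "out F" "action F"
    using F by (simp add: normal_factorization_def)
  interpret c: group_hom \<Gamma> "middle F" "into F"
    using F \<Gamma> M.G.group_axioms
    by (simp add: normal_factorization_def group_hom_def group_hom_axioms_def)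
  have out: "out F (into F y) = \<phi> y" if "y \<in> carrier \<Gamma>" for y
    using F that by (simp add: normal_factorization_def)
  have comm: "h \<otimes>\<^bsub>\<Gamma>\<^esub> k \<otimes>\<^bsub>\<Gamma>\<^esub> inv\<^bsub>\<Gamma>\<^esub> h \<otimes>\<^bsub>\<Gamma>\<^esub> inv\<^bsub>\<Gamma>\<^esub> k \<in> kernel \<Gamma> (middle F) (into F)"
    if "h \<in> carrier \<Gamma>" "k \<in> N" for h k
  proof -
    have k: "k \<in> carrier \<Gamma>" using that N by auto
    have "into F h \<otimes>\<^bsub>middle F\<^esub> into F k = into F k \<otimes>\<^bsub>middle F\<^esub> into F h"
      using M.swap[of "into F h" "into F k"] M.act_one[of "into F h"] that k
      by (simp add: out N(2))
    moreover have "into F (h \<otimes>\<^bsub>\<Gamma>\<^esub> k \<otimes>\<^bsub>\<Gamma>\<^esub> inv\<^bsub>\<Gamma>\<^esub> h \<otimes>\<^bsub>\<Gamma>\<^esub> inv\<^bsub>\<Gamma>\<^esub> k)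
      = (into F h \<otimes>\<^bsub>middle F\<^esub> into F k) \<otimes>\<^bsub>middle F\<^esub> inv\<^bsub>middle F\<^esub> (into F k \<otimes>\<^bsub>middle F\<^esub> into F h)"
      using that k by (simp add: M.G.inv_mult_group M.G.m_assoc)
    ultimately show ?thesis
      using that k by (simp add: kernel_def)
  qed
  have "commutator_subgroup \<Gamma> (carrier \<Gamma>) N \<subseteq> kernel \<Gamma> (middle F) (into F)"
    unfolding commutator_subgroup_def
    using comm by (intro c.G.generate_subgroup_incl c.subgroup_kernel) auto
  then show ?thesis using x by (auto simp: kernel_def)
qed

lemma (in group) commutator_subgroup_normal:
  assumes "N \<lhd> G"
  shows "commutator_subgroup G (carrier G) N \<lhd> G"
proof -
  interpret N: normal N G by (rule assms)
  have conj: "g \<otimes> (h \<otimes> k \<otimes> inv h \<otimes> inv k) \<otimes> inv g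
    = (g \<otimes> h \<otimes> inv g) \<otimes> (g \<otimes> k \<otimes> inv g) \<otimes> inv (g \<otimes> h \<otimes> inv g) \<otimes> inv (g \<otimes> k \<otimes> inv g)"
    if "g \<in> carrier G" "h \<in> carrier G" "k \<in> carrier G" for g h k
  proof -
    have [simp]: "inv g \<otimes> (g \<otimes> z) = z" if "z \<in> carrier G" for z
      using that \<open>g \<in> carrier G\<close> by (simp add: m_assoc[symmetric])
    show ?thesis using that by (simp add: m_assoc inv_mult_group)
  qed
  show ?thesis
    unfolding commutator_subgroup_def
  proof (rule normal_generateI)
    show "(\<Union>h\<in>carrier G. \<Union>k\<in>N. {h \<otimes> k \<otimes> inv h \<otimes> inv k}) \<subseteq> carrier G"
      using N.subset by auto
  next
    fix c g assume "c \<in> (\<Union>h\<in>carrier G. \<Union>k\<in>N. {h \<otimes> k \<otimes> inv h \<otimes> inv k})" and g: "g \<in> carrier G"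
    then obtain h k where c: "c = h \<otimes> k \<otimes> inv h \<otimes> inv k" "h \<in> carrier G" "k \<in> N" by auto
    have k: "k \<in> carrier G" using c N.subset by auto
    show "g \<otimes> c \<otimes> inv g \<in> (\<Union>h\<in>carrier G. \<Union>k\<in>N. {h \<otimes> k \<otimes> inv h \<otimes> inv k})"
      unfolding c(1) conj[OF g c(2) k]
    proof (intro UN_I)
      show "g \<otimes> h \<otimes> inv g \<in> carrier G" using g c by simp
      show "g \<otimes> k \<otimes> inv g \<in> N" using g c by (intro N.inv_op_closed2)
    qed (rule singletonI)
  qed
qed

lemma (in group) relative_series_normal:
  assumes "N \<lhd> G"
  shows "relative_series G N i \<lhd> G"
  by (induction i) (simp_all add: assms commutator_subgroup_normal)

lemma terminal_member_relative_series:
  assumes "terminal_member (relative_series \<Gamma> K) L"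
  obtains t where "L = relative_series \<Gamma> K t" "commutator_subgroup \<Gamma> (carrier \<Gamma>) L = L"
proof -
  obtain t where t: "relative_series \<Gamma> K t = L" "\<forall>s\<ge>t. relative_series \<Gamma> K s = relative_series \<Gamma> K t"
    using assms unfolding terminal_member_def by blast
  then have "relative_series \<Gamma> K (Suc t) = L" using le_SucI[OF order_refl] by blast
  then show thesis using that[of t] t(1) by simp
qed

text \<open>One step up the tower replaces a killed \<open>L\<close> by a killed \<open>[\<Gamma>, L]\<close>; since this is \<open>L\<close> again, nothing
  is lost in the induction.\<close>

lemma tower_hom_kills_stable:
  assumes \<phi>: "group_hom \<Gamma> G \<phi>"
    and L: "L \<subseteq> carrier \<Gamma>" "commutator_subgroup \<Gamma> (carrier \<Gamma>) L = L"
    and \<phi>L: "\<And>x. x \<in> L \<Longrightarrow> \<phi> x = \<one>\<^bsub>G\<^esub>"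
    and x: "x \<in> L"
  shows "tower_hom \<Gamma> G \<phi> i x = \<one>\<^bsub>tower_group \<Gamma> G \<phi> i\<^esub>"
  using x
proof (induction i arbitrary: x)
  case 0
  then show ?case
    by (simp add: tower_hom_def tower_group_def image_group_def \<phi>L)
next
  case (Suc i)
  interpret group_hom \<Gamma> G \<phi> by (rule \<phi>)
  let ?F = "normal_closure \<Gamma> (tower_group \<Gamma> G \<phi> i) (tower_hom \<Gamma> G \<phi> i)"
  have "normal_factorization \<Gamma> (tower_group \<Gamma> G \<phi> i) (tower_hom \<Gamma> G \<phi> i) ?F"
    using normal_closure_universal[OF tower_group_hom[OF \<phi>]] unfolding is_normal_closure_def by blast
  from normal_factorization_kills_commutators[OF G.group_axioms this L(1) Suc.IH, of x] Suc.prems L(2)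
  have "into ?F x = \<one>\<^bsub>middle ?F\<^esub>" by simp
  then show ?case by (simp add: tower_group_def tower_hom_def Let_def)
qed

section \<open>Isomorphic towers have isomorphic limits\<close>

lemma inverse_limit_iso:
  assumes iso: "\<And>i. \<theta> i \<in> iso (T i) (T' i)"
    and p: "\<And>i x. x \<in> carrier (T (Suc i)) \<Longrightarrow> p i x \<in> carrier (T i)"
    and p': "\<And>i x. x \<in> carrier (T (Suc i)) \<Longrightarrow> p' i (\<theta> (Suc i) x) = \<theta> i (p i x)"
  shows "inverse_limit T p \<cong> inverse_limit T' p'"
proof -
  have inj: "x = y" if "x \<in> carrier (T i)" "y \<in> carrier (T i)" "\<theta> i x = \<theta> i y" for i x y
    using iso[of i] that by (auto simp: iso_def bij_betw_def inj_on_def)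
  have surj: "\<exists>x\<in>carrier (T i). \<theta> i x = y" if "y \<in> carrier (T' i)" for i y
  proof -
    have "y \<in> \<theta> i ` carrier (T i)"
      using iso[of i] that by (simp add: iso_def bij_betw_def)
    then show ?thesis by (auto simp: image_iff)
  qed
  let ?f = "\<lambda>x i. \<theta> i (x i)"
  have "?f \<in> hom (inverse_limit T p) (inverse_limit T' p')"
    using iso by (auto simp: inverse_limit_def hom_def iso_def Pi_def p')
  moreover have "inj_on ?f (carrier (inverse_limit T p))"
    by (rule inj_onI, rule ext) (auto simp: inverse_limit_def fun_eq_iff intro: inj)
  moreover have "y \<in> ?f ` carrier (inverse_limit T p)" if y: "y \<in> carrier (inverse_limit T' p')" for y
  proof -
    have "\<forall>i. \<exists>x\<in>carrier (T i). \<theta> i x = y i"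
      using y surj by (auto simp: inverse_limit_def)
    then obtain x where x: "x i \<in> carrier (T i)" "\<theta> i (x i) = y i" for i
      by metis
    have "p i (x (Suc i)) = x i" for i
      using y x by (intro inj[of _ i]) (auto simp: p p'[symmetric] inverse_limit_def)
    then show ?thesis
      using x by (intro image_eqI[of _ _ x]) (auto simp: inverse_limit_def)
  qed
  ultimately have "?f \<in> iso (inverse_limit T p) (inverse_limit T' p')"
    by (auto simp: iso_def bij_betw_def hom_def)
  then show ?thesis by (auto simp: is_iso_def)
qed

text \<open>The isomorphism at level \<open>i + 1\<close> is constructed from the one at level \<open>i\<close>, and it has to be
  compatible both with the maps from \<open>\<Gamma>\<close>, to continue the construction, and with the maps of the
  towers, to pass to the limit.  Hence a dependent choice.\<close>

theorem tower_limit_cong: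
  fixes \<Gamma> :: "'a monoid" and \<Gamma>' :: "'c monoid" and G :: "'b monoid"
  assumes \<phi>: "group_hom \<Gamma> G \<phi>" and \<rho>: "group_hom \<Gamma>' G \<rho>"
    and q: "group_hom \<Gamma> \<Gamma>' q" "q ` carrier \<Gamma> = carrier \<Gamma>'"
    and comm: "\<And>x. x \<in> carrier \<Gamma> \<Longrightarrow> \<rho> (q x) = \<phi> x"
    and fibres: "\<And>i x y. x \<in> carrier \<Gamma> \<Longrightarrow> y \<in> carrier \<Gamma> \<Longrightarrow> q x = q y
      \<Longrightarrow> tower_hom \<Gamma> G \<phi> i x = tower_hom \<Gamma> G \<phi> i y"
  shows "tower_limit \<Gamma> G \<phi> \<cong> tower_limit \<Gamma>' G \<rho>"
proof -
  interpret \<phi>: group_hom \<Gamma> G \<phi> by (rule \<phi>)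
  let ?T = "tower_group \<Gamma> G \<phi>" and ?T' = "tower_group \<Gamma>' G \<rho>"
  let ?h = "tower_hom \<Gamma> G \<phi>" and ?h' = "tower_hom \<Gamma>' G \<rho>"
  let ?P = "\<lambda>i \<theta>. \<theta> \<in> iso (?T i) (?T' i) \<and> (\<forall>x\<in>carrier \<Gamma>. ?h' i (q x) = \<theta> (?h i x))"
  let ?Q = "\<lambda>i \<theta> u. \<forall>x\<in>carrier (?T (Suc i)). tower_map \<Gamma>' G \<rho> i (u x) = \<theta> (tower_map \<Gamma> G \<phi> i x)"
  have "\<exists>\<theta>. \<forall>i. ?P i (\<theta> i) \<and> ?Q i (\<theta> i) (\<theta> (Suc i))"
  proof (rule dependent_nat_choice)
    \<comment> \<open>The bottom groups are copies of \<open>G\<close> under \<open>Base\<close>, in two different types.\<close>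
    let ?\<theta> = "Base \<circ> inv_into (carrier G) Base"
    have "?\<theta> \<in> iso (?T 0) (?T' 0)"
      by (rule iso_set_trans[OF \<phi>.H.iso_set_sym tower_bottom(1)]) (rule tower_bottom)
    moreover have "?h' 0 (q x) = ?\<theta> (?h 0 x)" if "x \<in> carrier \<Gamma>" for x
      using that by (simp add: tower_bottom comm inv_into_f_f inj_on_def)
    ultimately show "\<exists>\<theta>. ?P 0 \<theta>" by blast
  next
    fix \<theta> i assume \<theta>: "?P i \<theta>"
    let ?F = "normal_closure \<Gamma> (?T i) (?h i)" and ?F' = "normal_closure \<Gamma>' (?T' i) (?h' i)"
    have T: "middle ?F = ?T (Suc i)" "into ?F = ?h (Suc i)" "out ?F = tower_map \<Gamma> G \<phi> i"
      and T': "middle ?F' = ?T' (Suc i)" "into ?F' = ?h' (Suc i)" "out ?F' = tower_map \<Gamma>' G \<rho> i"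
      by (simp_all add: tower_group_def tower_hom_def tower_map_def Let_def)
    note U = normal_closure_universal[OF tower_group_hom[OF \<phi>]]
    note U' = normal_closure_universal[OF tower_group_hom[OF \<rho>]]
    have \<theta>_iso: "\<theta> \<in> iso (?T i) (?T' i)"
      and square: "\<And>x. x \<in> carrier \<Gamma> \<Longrightarrow> ?h' i (q x) = \<theta> (?h i x)"
      using \<theta> by auto
    show "\<exists>u. ?P (Suc i) u \<and> ?Q i \<theta> u"
    proof (rule normal_closure_cong[OF U U U' U' q \<theta>_iso, unfolded T T'])
      fix u assume "u \<in> iso (?T (Suc i)) (?T' (Suc i))"
        "\<And>m. m \<in> carrier (?T (Suc i)) \<Longrightarrow> tower_map \<Gamma>' G \<rho> i (u m) = \<theta> (tower_map \<Gamma> G \<phi> i m)"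
        "\<And>x. x \<in> carrier \<Gamma> \<Longrightarrow> u (?h (Suc i) x) = ?h' (Suc i) (q x)"
      then show "\<exists>u. ?P (Suc i) u \<and> ?Q i \<theta> u" by (intro exI[of _ u]) simp
    qed (fact square, fact fibres)
  qed
  then obtain \<theta> where \<theta>: "?P i (\<theta> i)" "?Q i (\<theta> i) (\<theta> (Suc i))" for i
    by metis
  show ?thesis
    unfolding tower_limit_def
  proof (rule inverse_limit_iso[of \<theta>])
    show "\<theta> i \<in> iso (?T i) (?T' i)" for i
      using \<theta>(1)[of i] by (rule conjunct1)
    show "tower_map \<Gamma>' G \<rho> i (\<theta> (Suc i) x) = \<theta> i (tower_map \<Gamma> G \<phi> i x)"
      if "x \<in> carrier (?T (Suc i))" for i x
      using \<theta>(2)[of i] that by (rule bspec)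
  next
    fix i x assume x: "x \<in> carrier (?T (Suc i))"
    obtain act where "is_normal_closure TYPE('a) \<Gamma> (?T i) (?h i)
      \<lparr>middle = ?T (Suc i), action = act, into = ?h (Suc i), out = tower_map \<Gamma> G \<phi> i\<rparr>"
      by (rule tower_step[OF \<phi>])
    then have "normal_map (?T (Suc i)) (?T i) (tower_map \<Gamma> G \<phi> i) act"
      by (simp add: is_normal_closure_def normal_factorization_def)
    then interpret normal_map "?T (Suc i)" "?T i" "tower_map \<Gamma> G \<phi> i" act .
    show "tower_map \<Gamma> G \<phi> i x \<in> carrier (?T i)" using x by simp
  qed
qed

section \<open>The tower of the quotient by the terminal member\<close>

theorem proposition7:
  fixes \<Gamma> :: "'a monoid" and G :: "'b monoid" and \<phi> :: "'a \<Rightarrow> 'b"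
    and \<K> :: "'a set" and \<rho> :: "'a set \<Rightarrow> 'b"
  assumes "group_hom \<Gamma> G \<phi>"
    and "terminal_member (relative_series \<Gamma> (kernel \<Gamma> G \<phi>)) \<K>"
    and "\<forall>x\<in>carrier \<Gamma>. \<rho> (\<K> #>\<^bsub>\<Gamma>\<^esub> x) = \<phi> x"
  shows "tower_limit \<Gamma> G \<phi> \<cong> tower_limit (\<Gamma> Mod \<K>) G \<rho>"
proof -
  interpret group_hom \<Gamma> G \<phi> by (rule assms)
  obtain t where t: "\<K> = relative_series \<Gamma> (kernel \<Gamma> G \<phi>) t"
    and stable: "commutator_subgroup \<Gamma> (carrier \<Gamma>) \<K> = \<K>"
    by (rule terminal_member_relative_series[OF assms(2)])
  have "\<K> \<lhd> \<Gamma>"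
    unfolding t by (intro G.relative_series_normal normal_kernel)
  then interpret \<K>: normal \<K> \<Gamma> .
  have \<rho>: "\<rho> (\<K> #>\<^bsub>\<Gamma>\<^esub> x) = \<phi> x" if "x \<in> carrier \<Gamma>" for x
    using assms(3) that by blast
  have quot: "group_hom \<Gamma> (\<Gamma> Mod \<K>) (\<lambda>x. \<K> #>\<^bsub>\<Gamma>\<^esub> x)"
    by (simp add: group_hom_def group_hom_axioms_def \<K>.factorgroup_is_group \<K>.r_coset_hom_Mod
        G.group_axioms)
  have carrier_Mod: "carrier (\<Gamma> Mod \<K>) = (\<lambda>x. \<K> #>\<^bsub>\<Gamma>\<^esub> x) ` carrier \<Gamma>"
    by (auto simp: FactGroup_def RCOSETS_def)
  have "\<rho> \<in> hom (\<Gamma> Mod \<K>) G"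
    by (rule homI) (auto simp: carrier_Mod \<rho> \<K>.rcos_sum)
  then have hom\<rho>: "group_hom (\<Gamma> Mod \<K>) G \<rho>"
    by (simp add: group_hom_def group_hom_axioms_def \<K>.factorgroup_is_group H.group_axioms)
  \<comment> \<open>The value of \<open>\<rho>\<close> at the coset \<open>\<K>\<close> is both \<open>\<phi> k\<close> and \<open>\<phi> 1\<close>.\<close>
  have \<phi>\<K>: "\<phi> k = \<one>\<^bsub>G\<^esub>" if "k \<in> \<K>" for k
    using that \<rho>[of k] \<rho>[of "\<one>\<^bsub>\<Gamma>\<^esub>"] \<K>.subset by (simp add: \<K>.rcos_const G.coset_mult_one subsetD)
  show ?thesis
  proof (rule tower_limit_cong[OF assms(1) hom\<rho> quot carrier_Mod[symmetric] \<rho>])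
    fix i x y
    assume x: "x \<in> carrier \<Gamma>" and y: "y \<in> carrier \<Gamma>" and eq: "\<K> #>\<^bsub>\<Gamma>\<^esub> x = \<K> #>\<^bsub>\<Gamma>\<^esub> y"
    interpret h: group_hom \<Gamma> "tower_group \<Gamma> G \<phi> i" "tower_hom \<Gamma> G \<phi> i"
      by (rule tower_group_hom[OF assms(1)])
    have "x \<in> \<K> #>\<^bsub>\<Gamma>\<^esub> y"
      using G.rcos_self[OF x \<K>.subgroup_axioms] eq by simp
    then obtain k where k: "k \<in> \<K>" "x = k \<otimes>\<^bsub>\<Gamma>\<^esub> y" by (auto simp: r_coset_def)
    moreover have "tower_hom \<Gamma> G \<phi> i k = \<one>\<^bsub>tower_group \<Gamma> G \<phi> i\<^esub>"
      by (rule tower_hom_kills_stable[OF assms(1) \<K>.subset stable \<phi>\<K> k(1)])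
    ultimately show "tower_hom \<Gamma> G \<phi> i x = tower_hom \<Gamma> G \<phi> i y"
      using y \<K>.subset by auto
  qed
qed

end
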